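(* For $p\in(0,1)$ and $A\subseteq[0,n-1]$ random with each element included independently with probability $p$, let $m_{n;p}(k)=\mathbb{P}(2n-1-|A+A|=k)$ and $m_p(k)=\lim_{n\to\infty}m_{n;p}(k)$ (this limit exists). Then for every $p$ with $0.68\le p<1$, $$m_p(0)>m_p(1)\quad\text{and}\quad m_p(1)<m_p(2).$$
   Context: $[a,b]$ denotes the integers from $a$ to $b$; $A+A=\{a+a':a,a'\in A\}$. *)

theory Defs
  imports "HOL-Probability.Probability" "HOL-Library.Set_Algebras"
begin

definition random_subset :: "nat \<Rightarrow> real \<Rightarrow> nat set pmf" where
  "random_subset n p =
     map_pmf (\<lambda>f. {i. i < n \<and> f i}) (Pi_pmf {..<n} False (\<lambda>_. bernoulli_pmf p))"

text \<open>
  The sumset \<open>A + A\<close> is the elementwise sum of sets.  The number of missing sums is an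
  integer, so that no truncated subtraction is involved, also for \<open>n = 0\<close>.
\<close>

definition missing_sums :: "nat \<Rightarrow> nat set \<Rightarrow> int" where
  "missing_sums n A = 2 * int n - 1 - int (card (A + A))"

definition missing_prob :: "nat \<Rightarrow> real \<Rightarrow> nat \<Rightarrow> real" where
  "missing_prob n p k =
     measure_pmf.prob (random_subset n p) {A. missing_sums n A = int k}"

definition missing_lim_prob :: "real \<Rightarrow> nat \<Rightarrow> real" where
  "missing_lim_prob p k = lim (\<lambda>n. missing_prob n p k)"

end

theory Submission
  imports Defs
begin

text \<open>
  Missing sums occur only near the two ends of \<open>[0, 2n - 2]\<close>: a middle sum has many disjoint
  representations.  The ends are independent, and reflection identifies them, so
  \<open>m\<^sub>p(k) = \<Sum>i\<le>k. x\<^sub>i x\<^sub>k\<^sub>-\<^sub>i\<close>, where \<open>x\<^sub>i\<close> is the probability that a random \<open>A \<subseteq> \<nat>\<close> has exactly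
  \<open>i\<close> numbers missing from \<open>A + A\<close>.  The claim becomes \<open>x\<^sub>0 > 2 x\<^sub>1\<close> and
  \<open>2 x\<^sub>0 x\<^sub>2 + x\<^sub>1\<^sup>2 > 2 x\<^sub>0 x\<^sub>1\<close>.

  Looking at the first few elements of \<open>A\<close> and bounding the tail by a geometric series gives
  \<open>x\<^sub>0 \<ge> L\<close>, \<open>x\<^sub>0 + x\<^sub>1 \<le> K\<close> and \<open>x\<^sub>2 \<ge> q x\<^sub>0 + c\<close> with polynomials \<open>L\<close>, \<open>K\<close>, \<open>c\<close> in
  \<open>q = 1 - p\<close>; the summand \<open>q x\<^sub>0\<close> comes from the sets \<open>1 + B\<close> with \<open>B + B = \<nat>\<close>.  Both
  inequalities then reduce to the positivity of a polynomial in \<open>q\<close> on \<open>(0, 8/25]\<close>.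
\<close>

section \<open>Bernoulli random subsets\<close>

text \<open>The ground set is arbitrary, so that restrictions to blocks and images under injections
  stay in the same family.\<close>

definition bernoulli_set :: "real \<Rightarrow> 'a set \<Rightarrow> 'a set pmf" where
  "bernoulli_set p S = map_pmf (\<lambda>f. {i \<in> S. f i}) (Pi_pmf S False (\<lambda>_. bernoulli_pmf p))"

abbreviation bprob :: "real \<Rightarrow> 'a set \<Rightarrow> 'a set set \<Rightarrow> real" where
  "bprob p S \<equiv> measure_pmf.prob (bernoulli_set p S)"

lemma random_subset_eq_bernoulli_set: "random_subset n p = bernoulli_set p {..<n}"
  by (simp add: random_subset_def bernoulli_set_def)

lemma set_bernoulli_set: "set_pmf (bernoulli_set p S) \<subseteq> Pow S"
  by (auto simp: bernoulli_set_def)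

lemma measure_pmf_prob_cong:
  assumes "\<And>z. z \<in> set_pmf M \<Longrightarrow> z \<in> E \<longleftrightarrow> z \<in> F"
  shows "measure_pmf.prob M E = measure_pmf.prob M F"
proof -
  have "E \<inter> set_pmf M = F \<inter> set_pmf M"
    using assms by auto
  then show ?thesis by (metis measure_Int_set_pmf)
qed

lemma bprob_cong:
  assumes "\<And>A. A \<subseteq> S \<Longrightarrow> A \<in> E \<longleftrightarrow> A \<in> F"
  shows "bprob p S E = bprob p S F"
  using assms set_bernoulli_set[of p S] by (intro measure_pmf_prob_cong) auto

lemma bprob_mono:
  assumes "\<And>A. A \<subseteq> S \<Longrightarrow> A \<in> E \<Longrightarrow> A \<in> F"
  shows "bprob p S E \<le> bprob p S F"
proof -
  have "bprob p S E = bprob p S (E \<inter> Pow S)"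
    by (rule bprob_cong) auto
  also have "\<dots> \<le> bprob p S F"
    using assms by (intro measure_pmf.finite_measure_mono) auto
  finally show ?thesis .
qed

lemma bernoulli_set_empty: "bernoulli_set p {} = return_pmf {}"
  by (simp add: bernoulli_set_def)

lemma bernoulli_set_singleton:
  "bernoulli_set p {x} = map_pmf (\<lambda>b. if b then {x} else {}) (bernoulli_pmf p)"
  by (auto simp: bernoulli_set_def Pi_pmf_singleton pmf.map_comp o_def split: if_splits
      intro!: map_pmf_cong)

section \<open>Independence of disjoint blocks and transport along injections\<close>

lemma bernoulli_set_Un:
  assumes "finite S" "finite T" "S \<inter> T = {}"
  shows "bernoulli_set p (S \<union> T) =
    map_pmf (\<lambda>(A, B). A \<union> B) (pair_pmf (bernoulli_set p S) (bernoulli_set p T))"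
proof -
  have "bernoulli_set p (S \<union> T) =
      map_pmf (\<lambda>(f, g). {i \<in> S. f i} \<union> {i \<in> T. g i})
        (pair_pmf (Pi_pmf S False (\<lambda>_. bernoulli_pmf p)) (Pi_pmf T False (\<lambda>_. bernoulli_pmf p)))"
    unfolding bernoulli_set_def Pi_pmf_union[OF assms] pmf.map_comp
    using assms(3) by (intro map_pmf_cong) auto
  also have "\<dots> = map_pmf (\<lambda>(A, B). A \<union> B) (pair_pmf (bernoulli_set p S) (bernoulli_set p T))"
    unfolding bernoulli_set_def map_pair[symmetric] pmf.map_comp
    by (intro map_pmf_cong) auto
  finally show ?thesis .
qed

lemma bprob_Un:
  assumes "finite S" "finite T" "S \<inter> T = {}"
  shows "bprob p (S \<union> T) {A. A \<inter> S \<in> E \<and> A \<inter> T \<in> F} = bprob p S E * bprob p T F"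
proof -
  let ?Q = "pair_pmf (bernoulli_set p S) (bernoulli_set p T)"
  let ?V = "(\<lambda>(A, B). A \<union> B) -` {A. A \<inter> S \<in> E \<and> A \<inter> T \<in> F}"
  have supp: "A \<subseteq> S" "B \<subseteq> T" if "(A, B) \<in> set_pmf ?Q" for A B
    using that set_bernoulli_set[of p S] set_bernoulli_set[of p T] by auto
  have "bprob p (S \<union> T) {A. A \<inter> S \<in> E \<and> A \<inter> T \<in> F} = measure_pmf.prob ?Q ?V"
    by (simp add: bernoulli_set_Un[OF assms])
  \<comment> \<open>Intersecting with the power sets makes both events finite, hence countable, as
    \<open>measure_pmf_prob_product\<close> demands.\<close>
  also have "\<dots> = measure_pmf.prob ?Q ((E \<inter> Pow S) \<times> (F \<inter> Pow T))"
  proof -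
    have "(A \<union> B) \<inter> S = A" "(A \<union> B) \<inter> T = B" if "A \<subseteq> S" "B \<subseteq> T" for A B
      using that assms(3) by auto
    then have "z \<in> ?V \<longleftrightarrow> z \<in> (E \<inter> Pow S) \<times> (F \<inter> Pow T)" if "z \<in> set_pmf ?Q" for z
      using that supp[of "fst z" "snd z"] by (cases z) simp
    then show ?thesis by (rule measure_pmf_prob_cong)
  qed
  also have "\<dots> = bprob p S (E \<inter> Pow S) * bprob p T (F \<inter> Pow T)"
    using assms by (intro measure_pmf_prob_product) (auto intro: countable_finite)
  also have "bprob p S (E \<inter> Pow S) = bprob p S E"
    by (rule bprob_cong) auto
  also have "bprob p T (F \<inter> Pow T) = bprob p T F"
    by (rule bprob_cong) auto
  finally show ?thesis .
qed

lemma bprob_restrict: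
  assumes "finite S" "T \<subseteq> S"
  shows "bprob p S {A. A \<inter> T \<in> E} = bprob p T E"
  using bprob_Un[of T "S - T" p E UNIV] assms
  by (simp add: finite_subset[OF assms(2,1)] Un_absorb1)

lemma bprob_depends:
  assumes "finite S" "T \<subseteq> S" "\<And>A. A \<subseteq> S \<Longrightarrow> A \<in> E \<longleftrightarrow> A \<inter> T \<in> E"
  shows "bprob p S E = bprob p T E"
proof -
  have "bprob p S E = bprob p S {A. A \<inter> T \<in> E}"
    using assms(3) by (intro bprob_cong) auto
  then show ?thesis using bprob_restrict[OF assms(1,2)] by simp
qed

lemma bprob_indep:
  assumes "finite S" "T \<subseteq> S" "U \<subseteq> S" "T \<inter> U = {}"
  shows "bprob p S {A. A \<inter> T \<in> E \<and> A \<inter> U \<in> F} = bprob p T E * bprob p U F"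
proof -
  have fin: "finite T" "finite U"
    using assms by (auto intro: finite_subset)
  have TU: "A \<inter> (T \<union> U) \<inter> T = A \<inter> T" "A \<inter> (T \<union> U) \<inter> U = A \<inter> U" for A
    by auto
  have "bprob p S {A. A \<inter> T \<in> E \<and> A \<inter> U \<in> F} =
      bprob p S {A. A \<inter> (T \<union> U) \<in> {A. A \<inter> T \<in> E \<and> A \<inter> U \<in> F}}"
    by (simp add: TU)
  also have "\<dots> = bprob p (T \<union> U) {A. A \<inter> T \<in> E \<and> A \<inter> U \<in> F}"
    using assms by (intro bprob_restrict) auto
  also have "\<dots> = bprob p T E * bprob p U F"
    by (rule bprob_Un[OF fin assms(4)])
  finally show ?thesis .
qed

text \<open>Transports the law along the reflection \<open>i \<mapsto> n - 1 - i\<close> and the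
  shift \<open>i \<mapsto> i - 1\<close>; the induction adds one point at a time through
  \<open>bernoulli_set_Un\<close>.\<close>

lemma bernoulli_set_image:
  assumes "finite S" "inj_on g S"
  shows "bernoulli_set p (g ` S) = map_pmf (image g) (bernoulli_set p S)"
  using assms
proof (induction S rule: finite_induct)
  case empty
  then show ?case by (simp add: bernoulli_set_empty)
next
  case (insert x S)
  have sing: "bernoulli_set p {g x} = map_pmf (image g) (bernoulli_set p {x})"
    by (simp add: bernoulli_set_singleton pmf.map_comp o_def if_distrib cong: if_cong)
  have "bernoulli_set p (g ` insert x S) = bernoulli_set p ({g x} \<union> g ` S)"
    by simp
  also have "\<dots> = map_pmf (\<lambda>(A, B). A \<union> B)
      (pair_pmf (bernoulli_set p {g x}) (bernoulli_set p (g ` S)))"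
    using insert by (intro bernoulli_set_Un) auto
  also have "\<dots> = map_pmf (image g) (map_pmf (\<lambda>(A, B). A \<union> B)
      (pair_pmf (bernoulli_set p {x}) (bernoulli_set p S)))"
    using insert unfolding sing
    by (simp add: map_pair[symmetric] pmf.map_comp image_Un o_def split_def)
  also have "\<dots> = map_pmf (image g) (bernoulli_set p ({x} \<union> S))"
    using insert by (subst bernoulli_set_Un) auto
  finally show ?case by simp
qed

lemma bprob_image:
  assumes "finite S" "inj_on g S"
  shows "bprob p (g ` S) E = bprob p S {A. g ` A \<in> E}"
  by (simp add: bernoulli_set_image[OF assms] vimage_def)

lemma bprob_union_bound:
  assumes "finite I"
  shows "bprob p S {A. \<exists>i\<in>I. A \<in> E i} \<le> (\<Sum>i\<in>I. bprob p S (E i))"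
proof -
  have "{A. \<exists>i\<in>I. A \<in> E i} = (\<Union>i\<in>I. E i)" by auto
  then show ?thesis
    using measure_pmf.finite_measure_subadditive_finite[OF assms, of E "bernoulli_set p S"] by simp
qed

section \<open>Probabilities of cylinders and of missing a given sum\<close>

lemma bprob_subset_all:
  assumes p: "0 \<le> p" "p \<le> 1" and "finite I"
  shows "bprob p I {A. I \<subseteq> A} = p ^ card I"
  using assms(3)
proof (induction I rule: finite_induct)
  case empty
  then show ?case by simp
next
  case (insert x I)
  have sing: "bprob p {x} {A. x \<in> A} = p"
  proof -
    have "bprob p {x} {A. x \<in> A} = measure_pmf.prob (bernoulli_pmf p) {True}"
      by (auto simp: bernoulli_set_singleton intro!: arg_cong[where f = "measure_pmf.prob _"])
    then show ?thesis using p by (simp add: measure_pmf_single)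
  qed
  have "bprob p (insert x I) {A. insert x I \<subseteq> A} =
      bprob p ({x} \<union> I) {A. A \<inter> {x} \<in> {A. x \<in> A} \<and> A \<inter> I \<in> {A. I \<subseteq> A}}"
    by (auto intro!: bprob_cong)
  also have "\<dots> = bprob p {x} {A. x \<in> A} * bprob p I {A. I \<subseteq> A}"
    using insert by (intro bprob_Un) auto
  finally show ?case using insert by (simp add: sing)
qed

lemma bprob_disjoint_all:
  assumes p: "0 \<le> p" "p \<le> 1" and "finite I"
  shows "bprob p I {A. A \<inter> I = {}} = (1 - p) ^ card I"
  using assms(3)
proof (induction I rule: finite_induct)
  case empty
  then show ?case by simp
next
  case (insert x I)
  have sing: "bprob p {x} {A. x \<notin> A} = 1 - p"
  proof -
    have "bprob p {x} {A. x \<notin> A} = measure_pmf.prob (bernoulli_pmf p) {False}"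
      by (auto simp: bernoulli_set_singleton intro!: arg_cong[where f = "measure_pmf.prob _"])
    then show ?thesis using p by (simp add: measure_pmf_single)
  qed
  have "bprob p (insert x I) {A. A \<inter> insert x I = {}} =
      bprob p ({x} \<union> I) {A. A \<inter> {x} \<in> {A. x \<notin> A} \<and> A \<inter> I \<in> {A. A \<inter> I = {}}}"
    by (auto intro!: bprob_cong)
  also have "\<dots> = bprob p {x} {A. x \<notin> A} * bprob p I {A. A \<inter> I = {}}"
    using insert by (intro bprob_Un) auto
  finally show ?case using insert by (simp add: sing)
qed

lemma bprob_cylinder:
  assumes "0 \<le> p" "p \<le> 1" "finite S" "I \<subseteq> S" "J \<subseteq> S" "I \<inter> J = {}"
  shows "bprob p S {A. I \<subseteq> A \<and> A \<inter> J = {}} = p ^ card I * (1 - p) ^ card J"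
proof -
  have fin: "finite I" "finite J"
    using assms by (auto intro: finite_subset)
  have "bprob p S {A. I \<subseteq> A \<and> A \<inter> J = {}} =
      bprob p S {A. A \<inter> I \<in> {A. I \<subseteq> A} \<and> A \<inter> J \<in> {A. A \<inter> J = {}}}"
    by (rule bprob_cong) auto
  also have "\<dots> = p ^ card I * (1 - p) ^ card J"
    using assms fin by (subst bprob_indep) (simp_all add: bprob_subset_all bprob_disjoint_all)
  finally show ?thesis .
qed

text \<open>The window is symmetric about half of \<open>2 * i + r - 1\<close>. It splits into
  \<open>r div 2\<close> disjoint pairs with this sum, each incomplete with probability
  \<open>1 - p\<^sup>2\<close>, and for odd \<open>r\<close> a midpoint, absent with probability
  \<open>1 - p\<close>. The induction peels off the outermost pair.\<close>

lemma bprob_no_pair: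
  fixes i r :: nat
  assumes p: "0 \<le> p" "p \<le> 1"
  shows "bprob p {i..<i + r} {A. \<forall>t\<in>A. \<forall>u\<in>A. t + u + 1 \<noteq> 2 * i + r} =
    (1 - p\<^sup>2) ^ (r div 2) * (1 - p) ^ (r mod 2)"
proof (induction r arbitrary: i rule: induct_nat_012)
  case 0
  then show ?case by (simp add: bernoulli_set_empty)
next
  case 1
  have "bprob p {i..<i + Suc 0} {A. \<forall>t\<in>A. \<forall>u\<in>A. t + u + 1 \<noteq> 2 * i + Suc 0} =
      bprob p {i} {A. {} \<subseteq> A \<and> A \<inter> {i} = {}}"
    by (simp, rule bprob_cong) (auto simp: subset_singleton_iff)
  also have "\<dots> = 1 - p"
    using p by (subst bprob_cylinder) auto
  finally show ?case by simp
next
  case (ge2 r)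
  let ?S = "{i..<i + Suc (Suc r)}" and ?T = "{i, i + r + 1}" and ?U = "{Suc i..<Suc i + r}"
  let ?E = "\<lambda>N. {A. \<forall>t\<in>A. \<forall>u\<in>A. t + u + 1 \<noteq> (N::nat)}"
  have "bprob p ?S (?E (2 * i + Suc (Suc r))) =
      bprob p ?S {A. A \<inter> ?T \<in> {A. \<not> ?T \<subseteq> A} \<and> A \<inter> ?U \<in> ?E (2 * Suc i + r)}"
  proof (rule bprob_cong)
    fix A assume A: "A \<subseteq> ?S"
    have split: "t = i \<or> t = i + r + 1 \<or> t \<in> ?U" if "t \<in> A" for t
      using A that by force
    show "A \<in> ?E (2 * i + Suc (Suc r)) \<longleftrightarrow>
        A \<in> {A. A \<inter> ?T \<in> {A. \<not> ?T \<subseteq> A} \<and> A \<inter> ?U \<in> ?E (2 * Suc i + r)}"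
    proof
      assume E: "A \<in> ?E (2 * i + Suc (Suc r))"
      then have "i \<in> A \<Longrightarrow> i + r + 1 \<in> A \<Longrightarrow> i + (i + r + 1) + 1 \<noteq> 2 * i + Suc (Suc r)"
        by blast
      then have "\<not> (i \<in> A \<and> i + r + 1 \<in> A)" by auto
      then show "A \<in> {A. A \<inter> ?T \<in> {A. \<not> ?T \<subseteq> A} \<and> A \<inter> ?U \<in> ?E (2 * Suc i + r)}"
        using E by auto
    next
      assume R: "A \<in> {A. A \<inter> ?T \<in> {A. \<not> ?T \<subseteq> A} \<and> A \<inter> ?U \<in> ?E (2 * Suc i + r)}"
      then have T: "i \<notin> A \<or> i + r + 1 \<notin> A" by auto
      have "t + u + 1 \<noteq> 2 * i + Suc (Suc r)" if *: "t \<in> A" "u \<in> A" for t u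
      proof
        assume eq: "t + u + 1 = 2 * i + Suc (Suc r)"
        have "t \<in> ?U \<and> u \<in> ?U"
          using split[OF *(1)] split[OF *(2)] eq T * by auto
        then have "t \<in> A \<inter> ?U" "u \<in> A \<inter> ?U" using * by auto
        then have "t + u + 1 \<noteq> 2 * Suc i + r" using R by blast
        then show False using eq by simp
      qed
      then show "A \<in> ?E (2 * i + Suc (Suc r))" by blast
    qed
  qed
  also have "\<dots> = bprob p ?T {A. \<not> ?T \<subseteq> A} * bprob p ?U (?E (2 * Suc i + r))"
    by (intro bprob_indep) auto
  also have "bprob p ?T {A. \<not> ?T \<subseteq> A} = 1 - bprob p ?T {A. ?T \<subseteq> A}"
    by (subst measure_pmf.prob_compl[symmetric]) (auto intro!: arg_cong[where f = "measure_pmf.prob _"])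
  also have "bprob p ?T {A. ?T \<subseteq> A} = p\<^sup>2"
    using p by (subst bprob_subset_all) (auto simp: power2_eq_square)
  also have "bprob p ?U (?E (2 * Suc i + r)) = (1 - p\<^sup>2) ^ (r div 2) * (1 - p) ^ (r mod 2)"
    by (rule ge2.IH(1))
  finally show ?case by simp
qed

lemma bprob_prefix:
  assumes "0 \<le> p" "p \<le> 1" "D \<subseteq> {..<m}" "m \<le> h"
  shows "bprob p {..<h} {A. A \<inter> {..<m} = D} = p ^ card D * (1 - p) ^ (m - card D)"
proof -
  have "bprob p {..<h} {A. A \<inter> {..<m} = D} =
      bprob p {..<h} {A. D \<subseteq> A \<and> A \<inter> ({..<m} - D) = {}}"
    using assms(3) by (intro bprob_cong) auto
  also have "\<dots> = p ^ card D * (1 - p) ^ card ({..<m} - D)"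
    using assms by (intro bprob_cylinder) auto
  also have "card ({..<m} - D) = m - card D"
    using assms(3) by (simp add: card_Diff_subset finite_subset)
  finally show ?thesis .
qed

text \<open>Every \<open>d \<in> D\<close> forces \<open>s - d \<notin> A\<close>, and the remaining representations of \<open>s\<close> use disjoint
  pairs from \<open>{m..s - m}\<close>.\<close>

lemma bprob_prefix_missing:
  assumes p: "0 \<le> p" "p \<le> 1" and D: "D \<subseteq> {..<m}" and s: "2 * m \<le> s + 1" "s < h"
  shows "bprob p {..<h} {A. A \<inter> {..<m} = D \<and> s \<notin> A + A} \<le>
    p ^ card D * (1 - p) ^ (m - card D) * ((1 - p) ^ card D *
      ((1 - p\<^sup>2) ^ ((s + 1 - 2 * m) div 2) * (1 - p) ^ ((s + 1 - 2 * m) mod 2)))"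
proof -
  \<comment> \<open>The size of the window \<open>{m..s - m}\<close>; the hypothesis
    \<open>2 * m \<le> s + 1\<close> makes the subtraction exact.\<close>
  define r where "r = s + 1 - 2 * m"
  let ?W = "(\<lambda>d. s - d) ` D" and ?U = "{m..<m + r}"
  let ?E = "{A. \<forall>t\<in>A. \<forall>u\<in>A. t + u + 1 \<noteq> 2 * m + r}"
  have r: "2 * m + r = s + 1" using s by (simp add: r_def)
  \<comment> \<open>Since \<open>d < m\<close>, the excluded points \<open>s - d\<close> lie beyond
    the window, so the three blocks (prefix, window, excluded points) are disjoint and
    independent.\<close>
  have W: "s - d \<ge> m + r" "s - d \<le> s" "s - d \<ge> m" if "d \<in> D" for d
  proof -
    have "d < m" using that D by auto
    then show "s - d \<ge> m + r" "s - d \<le> s" "s - d \<ge> m" using r by auto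
  qed
  have inj: "inj_on (\<lambda>d. s - d) D"
    using D s by (intro inj_onI) (force dest!: subsetD)
  have cW: "card ?W = card D" by (rule card_image[OF inj])
  have fW: "finite ?W" using D by (auto intro: finite_subset)
  have "bprob p {..<h} {A. A \<inter> {..<m} = D \<and> s \<notin> A + A} \<le>
      bprob p {..<h} {A. A \<inter> {..<m} \<in> {D} \<and>
        A \<inter> (?W \<union> ?U) \<in> {B. B \<inter> ?W \<in> {B. B \<inter> ?W = {}} \<and> B \<inter> ?U \<in> ?E}}"
  proof (rule bprob_mono)
    fix A assume "A \<in> {A. A \<inter> {..<m} = D \<and> s \<notin> A + A}"
    then have pre: "A \<inter> {..<m} = D" and miss: "\<And>t u. t \<in> A \<Longrightarrow> u \<in> A \<Longrightarrow> t + u \<noteq> s"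
      by (auto simp: set_plus_def)
    have "s - d \<notin> A" if "d \<in> D" for d
      using miss[of d "s - d"] W(2)[OF that] pre that D s by fastforce
    then have "A \<inter> ?W = {}" by auto
    then show "A \<in> {A. A \<inter> {..<m} \<in> {D} \<and>
        A \<inter> (?W \<union> ?U) \<in> {B. B \<inter> ?W \<in> {B. B \<inter> ?W = {}} \<and> B \<inter> ?U \<in> ?E}}"
      using pre miss r by auto
  qed
  also have "\<dots> = bprob p {..<m} {D} *
      bprob p (?W \<union> ?U) {B. B \<inter> ?W \<in> {B. B \<inter> ?W = {}} \<and> B \<inter> ?U \<in> ?E}"
  proof (rule bprob_indep)
    show "{..<m} \<subseteq> {..<h}" using s by auto
    show "?W \<union> ?U \<subseteq> {..<h}" using s W(2) r by (auto intro: le_less_trans)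
    show "{..<m} \<inter> (?W \<union> ?U) = {}" using W(3) by force
  qed simp
  also have "bprob p {..<m} {D} = p ^ card D * (1 - p) ^ (m - card D)"
  proof -
    have "bprob p {..<m} {D} = bprob p {..<m} {A. A \<inter> {..<m} = D}"
      by (rule bprob_cong) auto
    then show ?thesis using bprob_prefix[OF p D, of m] by simp
  qed
  also have "bprob p (?W \<union> ?U) {B. B \<inter> ?W \<in> {B. B \<inter> ?W = {}} \<and> B \<inter> ?U \<in> ?E} =
      bprob p ?W {B. B \<inter> ?W = {}} * bprob p ?U ?E"
    using fW W(1) by (intro bprob_Un) force+
  also have "bprob p ?W {B. B \<inter> ?W = {}} = (1 - p) ^ card D"
    using bprob_disjoint_all[OF p fW] cW by simp
  also have "bprob p ?U ?E = (1 - p\<^sup>2) ^ (r div 2) * (1 - p) ^ (r mod 2)"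
    by (rule bprob_no_pair[OF p])
  finally show ?thesis by (simp add: r_def)
qed

text \<open>The exponents \<open>2 * j\<close> and \<open>2 * j + 1\<close> together contribute
  \<open>(1 + q) * a ^ j\<close>, which leaves a geometric series starting at
  \<open>j = k\<close>.\<close>

lemma sum_pair_weights_le:
  fixes a q :: real
  assumes "0 \<le> a" "a < 1" "0 \<le> q"
  shows "(\<Sum>s | s < h \<and> 2 * (m + k) \<le> s + 1. a ^ ((s + 1 - 2 * m) div 2) * q ^ ((s + 1 - 2 * m) mod 2))
    \<le> (1 + q) * a ^ k / (1 - a)"
proof -
  let ?f = "\<lambda>r. a ^ (r div 2) * q ^ (r mod 2)"
  let ?I = "{s. s < h \<and> 2 * (m + k) \<le> s + 1}"
  have "(\<Sum>s\<in>?I. ?f (s + 1 - 2 * m)) = sum ?f ((\<lambda>s. s + 1 - 2 * m) ` ?I)"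
    by (subst sum.reindex) (auto simp: inj_on_def)
  \<comment> \<open>The index range is enlarged to consist of complete pairs \<open>2 * j\<close>,
    \<open>2 * j + 1\<close>.\<close>
  also have "\<dots> \<le> sum ?f {2 * k..<2 * k + 2 * (h + 1)}"
    using assms by (intro sum_mono2) auto
  also have "\<dots> = (1 + q) * a ^ k * (\<Sum>j<h + 1. a ^ j)"
  proof -
    have "sum ?f {2 * k..<2 * k + 2 * J} = (1 + q) * a ^ k * (\<Sum>j<J. a ^ j)" for J
    proof (induction J)
      case (Suc J)
      have "sum ?f {2 * k..<2 * k + 2 * Suc J} =
          sum ?f {2 * k..<2 * k + 2 * J} + ?f (2 * (k + J)) + ?f (2 * (k + J) + 1)"
        by (simp add: algebra_simps)
      also have "?f (2 * (k + J)) = a ^ (k + J)"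
        by simp
      also have "?f (2 * (k + J) + 1) = a ^ (k + J) * q"
        proof -
        have "(2 * (k + J) + 1) div 2 = k + J" "(2 * (k + J) + 1) mod 2 = 1" by presburger+
        then show ?thesis by simp
      qed
      also have "sum ?f {2 * k..<2 * k + 2 * J} + a ^ (k + J) + a ^ (k + J) * q =
          (1 + q) * a ^ k * (\<Sum>j<Suc J. a ^ j)"
        unfolding Suc.IH by (simp add: algebra_simps power_add)
      finally show ?case .
    qed simp
    then show ?thesis .
  qed
  also have "(\<Sum>j<h + 1. a ^ j) = (1 - a ^ (h + 1)) / (1 - a)"
    using assms by (subst sum_gp_strict) auto
  also have "(1 + q) * a ^ k * \<dots> \<le> (1 + q) * a ^ k * (1 / (1 - a))"
    using assms by (intro mult_left_mono divide_right_mono) auto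
  finally show ?thesis by simp
qed

text \<open>A union bound over \<open>s\<close> with geometric ratio \<open>1 - p\<^sup>2\<close>.
  The parameter \<open>k\<close> postpones the start of the tail to
  \<open>s = 2 * (m + k) - 1\<close>, so that the smaller sums can be treated exactly.\<close>

lemma bprob_prefix_tail:
  assumes p: "0 < p" "p \<le> 1" and D: "D \<subseteq> {..<m}"
  shows "bprob p {..<h} {A. A \<inter> {..<m} = D \<and> (\<exists>s<h. 2 * (m + k) \<le> s + 1 \<and> s \<notin> A + A)} \<le>
    p ^ card D * (1 - p) ^ (m - card D) *
      ((1 - p) ^ card D * ((1 + (1 - p)) * (1 - p\<^sup>2) ^ k / p\<^sup>2))"
proof -
  let ?I = "{s. s < h \<and> 2 * (m + k) \<le> s + 1}"
  let ?c = "p ^ card D * (1 - p) ^ (m - card D)"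
  let ?f = "\<lambda>s. (1 - p\<^sup>2) ^ ((s + 1 - 2 * m) div 2) * (1 - p) ^ ((s + 1 - 2 * m) mod 2)"
  have a: "0 \<le> 1 - p\<^sup>2" "1 - p\<^sup>2 < 1" using p by (auto simp: power_le_one)
  have "bprob p {..<h} {A. A \<inter> {..<m} = D \<and> (\<exists>s<h. 2 * (m + k) \<le> s + 1 \<and> s \<notin> A + A)} =
      bprob p {..<h} {A. \<exists>s\<in>?I. A \<in> {A. A \<inter> {..<m} = D \<and> s \<notin> A + A}}"
    by (rule bprob_cong) auto
  also have "\<dots> \<le> (\<Sum>s\<in>?I. bprob p {..<h} {A. A \<inter> {..<m} = D \<and> s \<notin> A + A})"
    by (rule bprob_union_bound) auto
  also have "\<dots> \<le> (\<Sum>s\<in>?I. ?c * ((1 - p) ^ card D * ?f s))"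
    using p D by (intro sum_mono bprob_prefix_missing) auto
  also have "\<dots> = ?c * ((1 - p) ^ card D * sum ?f ?I)"
    by (simp add: sum_distrib_left)
  also have "\<dots> \<le> ?c * ((1 - p) ^ card D * ((1 + (1 - p)) * (1 - p\<^sup>2) ^ k / (1 - (1 - p\<^sup>2))))"
    using p a by (intro mult_left_mono sum_pair_weights_le) auto
  finally show ?thesis by simp
qed

section \<open>Convergence to the convolution of two fringes\<close>

definition missing_below :: "nat \<Rightarrow> nat set \<Rightarrow> nat set" where
  "missing_below h A = {s. s < h \<and> s \<notin> A + A}"

definition fringe_prob :: "real \<Rightarrow> nat \<Rightarrow> nat \<Rightarrow> real" where
  "fringe_prob p h k = bprob p {..<h} {A. card (missing_below h A) = k}"

text \<open>The probability for a random subset of the naturals, encoded as a limit over finite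
  windows; existence of the limit is \<open>fringe_prob_tendsto\<close>.\<close>

definition fringe_lim :: "real \<Rightarrow> nat \<Rightarrow> real" where
  "fringe_lim p k = lim (\<lambda>h. fringe_prob p h k)"

text \<open>The bound of \<open>bprob_prefix_tail\<close> for the empty prefix of length 0 and
  \<open>k = h div 2\<close>.\<close>

definition tail_bound :: "real \<Rightarrow> nat \<Rightarrow> real" where
  "tail_bound p h = (1 + (1 - p)) * (1 - p\<^sup>2) ^ (h div 2) / p\<^sup>2"

lemma finite_missing_below [simp]: "finite (missing_below h A)"
  by (simp add: missing_below_def)

lemma missing_below_restrict: "h \<le> m \<Longrightarrow> missing_below h (A \<inter> {..<m}) = missing_below h A"
  by (fastforce simp: missing_below_def set_plus_def)

text \<open>Sums below \<open>h\<close> involve only elements below \<open>h\<close>, so windows of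
  different lengths can be compared on one sample.\<close>

lemma bprob_card_missing_below:
  assumes "h \<le> n"
  shows "bprob p {..<n} {A. card (missing_below h A) = k} = fringe_prob p h k"
  unfolding fringe_prob_def using assms by (intro bprob_depends) (auto simp: missing_below_restrict)

section \<open>Truncation error and existence of the fringe limits\<close>

lemma bprob_tail_le:
  assumes "0 < p" "p \<le> 1"
  shows "bprob p {..<n} {A. \<exists>s<n. h \<le> s \<and> s \<notin> A + A} \<le> tail_bound p h"
proof -
  have "bprob p {..<n} {A. \<exists>s<n. h \<le> s \<and> s \<notin> A + A} \<le>
      bprob p {..<n} {A. A \<inter> {..<0} = {} \<and> (\<exists>s<n. 2 * (0 + h div 2) \<le> s + 1 \<and> s \<notin> A + A)}"
    by (rule bprob_mono) fastforce
  also have "\<dots> \<le> tail_bound p h"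
    using bprob_prefix_tail[OF assms, of "{}" 0 n "h div 2"] by (simp add: tail_bound_def)
  finally show ?thesis .
qed

lemma tail_bound_tendsto:
  assumes "0 < p" "p \<le> 1"
  shows "tail_bound p \<longlonglongrightarrow> 0"
proof -
  have "filterlim (\<lambda>h::nat. h div 2) at_top sequentially"
    by (rule filterlim_at_top_div_const_nat) simp
  moreover have "(\<lambda>n. (1 - p\<^sup>2) ^ n) \<longlonglongrightarrow> 0"
    using assms by (intro LIMSEQ_realpow_zero) (auto simp: power_le_one)
  ultimately have "(\<lambda>h. (1 - p\<^sup>2) ^ (h div 2)) \<longlonglongrightarrow> 0"
    by (rule filterlim_compose[rotated])
  from tendsto_mult[OF tendsto_const[of "(1 + (1 - p)) / p\<^sup>2"] this]
  show ?thesis by (simp add: tail_bound_def[abs_def])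
qed

lemma bprob_diff_le:
  assumes "\<And>A. A \<subseteq> S \<Longrightarrow> A \<notin> B \<Longrightarrow> A \<in> E \<longleftrightarrow> A \<in> F"
  shows "\<bar>bprob p S E - bprob p S F\<bar> \<le> bprob p S B"
proof -
  have "bprob p S E \<le> bprob p S (F \<union> B)" "bprob p S F \<le> bprob p S (E \<union> B)"
    using assms by (intro bprob_mono; blast)+
  then show ?thesis
    using measure_Un_le[of F "bernoulli_set p S" B] measure_Un_le[of E "bernoulli_set p S" B]
    by auto
qed

text \<open>On a common sample from \<open>{..<n}\<close> the two counts differ only if some sum in
  \<open>{h..<n}\<close> is missing. As \<open>tail_bound\<close> tends to 0, the sequence is
  Cauchy.\<close>

lemma fringe_prob_dist:
  assumes "0 < p" "p \<le> 1" "h \<le> n"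
  shows "\<bar>fringe_prob p n k - fringe_prob p h k\<bar> \<le> tail_bound p h"
proof -
  have "\<bar>bprob p {..<n} {A. card (missing_below n A) = k} -
      bprob p {..<n} {A. card (missing_below h A) = k}\<bar> \<le>
      bprob p {..<n} {A. \<exists>s<n. h \<le> s \<and> s \<notin> A + A}"
  proof (rule bprob_diff_le)
    fix A assume "A \<notin> {A. \<exists>s<n. h \<le> s \<and> s \<notin> A + A}"
    then have "missing_below n A = missing_below h A"
      using assms(3) by (auto simp: missing_below_def not_le[symmetric])
    then show "A \<in> {A. card (missing_below n A) = k} \<longleftrightarrow> A \<in> {A. card (missing_below h A) = k}"
      by simp
  qed
  then show ?thesis
    using bprob_tail_le[OF assms(1,2), of n h] assms(3)
    by (simp add: bprob_card_missing_below)
qed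

lemma fringe_prob_tendsto:
  assumes "0 < p" "p \<le> 1"
  shows "(\<lambda>h. fringe_prob p h k) \<longlonglongrightarrow> fringe_lim p k"
proof -
  have "Cauchy (\<lambda>h. fringe_prob p h k)"
  proof (rule CauchyI)
    fix e :: real assume "0 < e"
    then have "\<forall>\<^sub>F h in sequentially. tail_bound p h < e / 2"
      using order_tendstoD(2)[OF tail_bound_tendsto[OF assms], of "e / 2"] by simp
    then obtain M where M: "tail_bound p M < e / 2"
      by (auto simp: eventually_sequentially)
    have "norm (fringe_prob p m k - fringe_prob p n k) < e" if "m \<ge> M" "n \<ge> M" for m n
      using fringe_prob_dist[OF assms that(1), of k] fringe_prob_dist[OF assms that(2), of k] M
      by (simp add: abs_if split: if_splits)
    then show "\<exists>M. \<forall>m\<ge>M. \<forall>n\<ge>M. norm (fringe_prob p m k - fringe_prob p n k) < e"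
      by blast
  qed
  then show ?thesis
    unfolding fringe_lim_def by (simp add: Cauchy_convergent_iff convergent_LIMSEQ_iff)
qed

section \<open>Reflection and decoupling of the two ends\<close>

lemma reflect_mem_sumset:
  fixes A :: "nat set"
  assumes "A \<subseteq> {..<n}" "s \<le> 2 * n - 2"
  shows "s \<in> (\<lambda>i. n - 1 - i) ` A + (\<lambda>i. n - 1 - i) ` A \<longleftrightarrow> 2 * n - 2 - s \<in> A + A"
proof
  assume "s \<in> (\<lambda>i. n - 1 - i) ` A + (\<lambda>i. n - 1 - i) ` A"
  then obtain a b where ab: "a \<in> A" "b \<in> A" "s = (n - 1 - a) + (n - 1 - b)"
    by (auto simp: set_plus_def)
  then have "a < n" "b < n" using assms by auto
  then have "2 * n - 2 - s = a + b" using ab by auto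
  then show "2 * n - 2 - s \<in> A + A" using ab by (auto simp: set_plus_def)
next
  assume "2 * n - 2 - s \<in> A + A"
  then obtain a b where ab: "a \<in> A" "b \<in> A" "2 * n - 2 - s = a + b"
    by (auto simp: set_plus_def)
  then have "a < n" "b < n" using assms by auto
  then have "s = (n - 1 - a) + (n - 1 - b)" using ab assms by auto
  then show "s \<in> (\<lambda>i. n - 1 - i) ` A + (\<lambda>i. n - 1 - i) ` A"
    using ab by (auto simp: set_plus_def)
qed

text \<open>If no middle sum is missing, the gaps of \<open>A + A\<close> are the disjoint union of
  the gaps below \<open>h\<close> and the mirror images of the gaps below \<open>h\<close> of the
  reflected set.\<close>

lemma missing_sums_eq_fringes:
  fixes n h :: nat
  defines "g \<equiv> \<lambda>i. n - 1 - i"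
  assumes A: "A \<subseteq> {..<n}" and h: "2 * h \<le> n" "0 < n"
    and left: "\<not> (\<exists>s<n. h \<le> s \<and> s \<notin> A + A)"
    and right: "\<not> (\<exists>s<n. h \<le> s \<and> s \<notin> g ` A + g ` A)"
  shows "missing_sums n A = int (card (missing_below h A) + card (missing_below h (g ` A)))"
proof -
  let ?f = "\<lambda>s. 2 * n - 2 - s"
  have sub: "A + A \<subseteq> {..<2 * n - 1}"
  proof
    fix s assume "s \<in> A + A"
    then obtain a b where "a \<in> A" "b \<in> A" "s = a + b" by (auto simp: set_plus_def)
    moreover from this have "a < n" "b < n" using A by auto
    ultimately show "s \<in> {..<2 * n - 1}" by auto
  qed
  \<comment> \<open>Sums below \<open>n\<close> are covered by \<open>left\<close>; a sum of at
    least \<open>n\<close> reflects to one below \<open>n\<close>, covered by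
    \<open>right\<close>.\<close>
  have mid: "s \<in> A + A" if "h \<le> s" "s \<le> 2 * n - 2 - h" for s
  proof (cases "s < n")
    case True
    then show ?thesis using left that by auto
  next
    case False
    then have "?f s \<in> g ` A + g ` A" using right that h by auto
    then have "?f (?f s) \<in> A + A"
      using reflect_mem_sumset[OF A, of "?f s"] by (simp add: g_def)
    moreover have "?f (?f s) = s" using that h by auto
    ultimately show ?thesis by simp
  qed
  have refl: "s \<in> g ` A + g ` A \<longleftrightarrow> ?f s \<in> A + A" if "s < h" for s
    using reflect_mem_sumset[OF A, of s] that h by (simp add: g_def)
  have "{..<2 * n - 1} - (A + A) = missing_below h A \<union> ?f ` missing_below h (g ` A)"
  proof (intro equalityI subsetI)
    fix s assume s: "s \<in> {..<2 * n - 1} - (A + A)"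
    show "s \<in> missing_below h A \<union> ?f ` missing_below h (g ` A)"
    proof (cases "s < h")
      case True
      then show ?thesis using s by (auto simp: missing_below_def)
    next
      case False
      then have "\<not> s \<le> 2 * n - 2 - h" using mid[of s] s by (auto simp: not_less)
      then have "?f s < h" using s False by auto
      moreover have "?f (?f s) = s" using s by auto
      ultimately have "?f s \<in> missing_below h (g ` A)"
        using refl[of "?f s"] s by (simp add: missing_below_def)
      then show ?thesis using \<open>?f (?f s) = s\<close> by (metis UnI2 imageI)
    qed
  next
    fix s assume "s \<in> missing_below h A \<union> ?f ` missing_below h (g ` A)"
    then show "s \<in> {..<2 * n - 1} - (A + A)"
      using refl h by (auto simp: missing_below_def)
  qed
  moreover have "missing_below h A \<inter> ?f ` missing_below h (g ` A) = {}"
    using h by (auto simp: missing_below_def)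
  moreover have "card (?f ` missing_below h (g ` A)) = card (missing_below h (g ` A))"
    using h by (intro card_image) (auto simp: inj_on_def missing_below_def)
  ultimately have "card ({..<2 * n - 1} - (A + A)) =
      card (missing_below h A) + card (missing_below h (g ` A))"
    by (simp add: card_Un_disjoint)
  moreover have "card ({..<2 * n - 1} - (A + A)) = 2 * n - 1 - card (A + A)"
    using sub by (simp add: card_Diff_subset finite_subset[OF sub])
  moreover have "card (A + A) \<le> 2 * n - 1"
    using card_mono[OF _ sub] by simp
  ultimately show ?thesis
    using h by (simp add: missing_sums_def of_nat_diff)
qed

text \<open>The two counts depend on the first and the last \<open>h\<close> positions. These blocks
  are disjoint because \<open>2 * h \<le> n\<close>, and the reflection carries the last onto the
  first, so the counts are independent with the same law.\<close>

lemma bprob_fringes: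
  fixes n h :: nat
  defines "g \<equiv> \<lambda>i. n - 1 - i"
  assumes h: "2 * h \<le> n"
  shows "bprob p {..<n} {A. card (missing_below h A) + card (missing_below h (g ` A)) = k} =
    (\<Sum>i\<le>k. fringe_prob p h i * fringe_prob p h (k - i))"
proof -
  let ?T = "{..<h}" and ?U = "{n - h..<n}"
  let ?L = "\<lambda>i. {A. card (missing_below h A) = i}"
  let ?R = "\<lambda>i. {A. card (missing_below h (g ` A)) = i}"
  have gU: "g ` ?U = ?T"
  proof (intro equalityI subsetI)
    fix x assume "x \<in> {..<h}"
    then have "x = g (n - 1 - x)" "n - 1 - x \<in> ?U" using h by (auto simp: g_def)
    then show "x \<in> g ` ?U" by blast
  qed (use h in \<open>auto simp: g_def\<close>)
  have inj: "inj_on g ?U" by (auto simp: g_def inj_on_def)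
  have right: "missing_below h (g ` A) = missing_below h (g ` (A \<inter> ?U))" if "A \<subseteq> {..<n}" for A
  proof -
    have "g ` A \<inter> {..<h} = g ` (A \<inter> ?U) \<inter> {..<h}"
      using that h by (fastforce simp: g_def)
    then show ?thesis
      using missing_below_restrict[of h h] by (metis order_refl)
  qed
  have one: "bprob p {..<n} (?L i \<inter> ?R j) = fringe_prob p h i * fringe_prob p h j" for i j
  proof -
    have "bprob p {..<n} (?L i \<inter> ?R j) = bprob p {..<n} {A. A \<inter> ?T \<in> ?L i \<and> A \<inter> ?U \<in> ?R j}"
      using right by (intro bprob_cong) (auto simp: missing_below_restrict)
    also have "\<dots> = bprob p ?T (?L i) * bprob p ?U (?R j)"
      using h by (intro bprob_indep) auto
    also have "bprob p ?U (?R j) = bprob p (g ` ?U) (?L j)"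
      by (subst bprob_image[OF _ inj]) auto
    finally show ?thesis by (simp add: gU fringe_prob_def)
  qed
  have "{A. card (missing_below h A) + card (missing_below h (g ` A)) = k} =
      (\<Union>i\<le>k. ?L i \<inter> ?R (k - i))"
    by auto
  then have "bprob p {..<n} {A. card (missing_below h A) + card (missing_below h (g ` A)) = k} =
      (\<Sum>i\<le>k. bprob p {..<n} (?L i \<inter> ?R (k - i)))"
    by (simp, intro measure_pmf.finite_measure_finite_Union)
      (auto simp: disjoint_family_on_def)
  then show ?thesis by (simp add: one)
qed

text \<open>The identity of \<open>missing_sums_eq_fringes\<close> can fail only if a sum in
  \<open>{h..<n}\<close> is missing for \<open>A\<close> or for its reflection; these two events
  have equal probability, hence the factor 2.\<close>

lemma missing_prob_approx:
  assumes p: "0 < p" "p \<le> 1" and h: "2 * h \<le> n" "0 < n"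
  shows "\<bar>missing_prob n p k - (\<Sum>i\<le>k. fringe_prob p h i * fringe_prob p h (k - i))\<bar>
    \<le> 2 * tail_bound p h"
proof -
  define g where "g = (\<lambda>i. n - 1 - i)"
  let ?B = "{A. \<exists>s<n. h \<le> s \<and> s \<notin> A + A}"
  have bij: "g ` {..<n} = {..<n}"
  proof (intro equalityI subsetI)
    fix x assume "x \<in> {..<n}"
    then have "x = g (n - 1 - x)" "n - 1 - x \<in> {..<n}" by (auto simp: g_def)
    then show "x \<in> g ` {..<n}" by blast
  qed (auto simp: g_def)
  have inj: "inj_on g {..<n}" by (auto simp: g_def inj_on_def)
  have "\<bar>bprob p {..<n} {A. missing_sums n A = int k} -
      bprob p {..<n} {A. card (missing_below h A) + card (missing_below h (g ` A)) = k}\<bar> \<le>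
      bprob p {..<n} (?B \<union> {A. g ` A \<in> ?B})"
  proof (rule bprob_diff_le)
    fix A assume "A \<subseteq> {..<n}" "A \<notin> ?B \<union> {A. g ` A \<in> ?B}"
    then have "missing_sums n A = int (card (missing_below h A) + card (missing_below h (g ` A)))"
      using missing_sums_eq_fringes[OF _ h, of A] by (simp add: g_def)
    then show "A \<in> {A. missing_sums n A = int k} \<longleftrightarrow>
        A \<in> {A. card (missing_below h A) + card (missing_below h (g ` A)) = k}"
      by (simp del: of_nat_add)
  qed
  also have "\<dots> \<le> bprob p {..<n} ?B + bprob p {..<n} {A. g ` A \<in> ?B}"
    by (rule measure_Un_le) auto
  also have "bprob p {..<n} {A. g ` A \<in> ?B} = bprob p {..<n} ?B"
    using bprob_image[OF _ inj, of p ?B] bij by simp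
  also have "bprob p {..<n} ?B \<le> tail_bound p h"
    by (rule bprob_tail_le[OF p])
  finally show ?thesis
    unfolding g_def bprob_fringes[OF h(1)] missing_prob_def random_subset_eq_bernoulli_set
    by simp
qed

lemma missing_prob_tendsto:
  assumes p: "0 < p" "p \<le> 1"
  shows "(\<lambda>n. missing_prob n p k) \<longlonglongrightarrow> (\<Sum>i\<le>k. fringe_lim p i * fringe_lim p (k - i))"
proof -
  let ?S = "\<lambda>h. \<Sum>i\<le>k. fringe_prob p h i * fringe_prob p h (k - i)"
  \<comment> \<open>The fringe length \<open>h = n div 2\<close> satisfies
    \<open>2 * h \<le> n\<close> and still tends to infinity, so the error vanishes.\<close>
  have half: "filterlim (\<lambda>n::nat. n div 2) at_top sequentially"
    by (rule filterlim_at_top_div_const_nat) simp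
  have "?S \<longlonglongrightarrow> (\<Sum>i\<le>k. fringe_lim p i * fringe_lim p (k - i))"
    by (intro tendsto_intros fringe_prob_tendsto p)
  then have S: "(\<lambda>n. ?S (n div 2)) \<longlonglongrightarrow> (\<Sum>i\<le>k. fringe_lim p i * fringe_lim p (k - i))"
    by (rule filterlim_compose[OF _ half])
  have T: "(\<lambda>n. 2 * tail_bound p (n div 2)) \<longlonglongrightarrow> 0"
    using tendsto_mult[OF tendsto_const[of 2] filterlim_compose[OF tail_bound_tendsto[OF p] half]]
    by simp
  have "(\<lambda>n. missing_prob n p k - ?S (n div 2)) \<longlonglongrightarrow> 0"
  proof (rule Lim_null_comparison[OF _ T])
    show "\<forall>\<^sub>F n in sequentially. norm (missing_prob n p k - ?S (n div 2)) \<le> 2 * tail_bound p (n div 2)"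
      using eventually_gt_at_top[of 0]
      by eventually_elim (use missing_prob_approx[OF p] in auto)
  qed
  from tendsto_add[OF this S] show ?thesis by simp
qed

section \<open>Bounds on the fringe probabilities\<close>

text \<open>Takes expectations of a pointwise inequality between sums of indicators. Several events
  on the left allow subtracted terms to be moved there instead of computing set differences.\<close>

lemma bprob_weighted_cover:
  assumes "finite S"
    and cover: "\<And>A. A \<subseteq> S \<Longrightarrow> (\<Sum>E\<leftarrow>Es. indicator E A :: real) \<le> (\<Sum>F\<leftarrow>Fs. indicator F A)"
  shows "(\<Sum>E\<leftarrow>Es. bprob p S E) \<le> (\<Sum>F\<leftarrow>Fs. bprob p S F)"
proof -
  have sum: "(\<Sum>E\<leftarrow>Es. bprob p S E) =
      (\<Sum>A\<in>Pow S. pmf (bernoulli_set p S) A * (\<Sum>E\<leftarrow>Es. indicator E A))" for Es :: "'a set set list"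
  proof -
    have "bprob p S E = (\<Sum>A\<in>Pow S. pmf (bernoulli_set p S) A * indicator E A)" for E
    proof -
      have "bprob p S E = bprob p S (E \<inter> Pow S)"
        by (rule bprob_cong) auto
      also have "\<dots> = (\<Sum>A\<in>E \<inter> Pow S. pmf (bernoulli_set p S) A)"
        using assms(1) by (intro measure_measure_pmf_finite) auto
      also have "\<dots> = (\<Sum>A\<in>Pow S. pmf (bernoulli_set p S) A * indicator E A)"
        using assms(1) by (simp add: sum.inter_restrict indicator_def if_distrib Int_commute cong: if_cong)
      finally show ?thesis .
    qed
    then show ?thesis
      by (induction Es) (simp_all add: distrib_left sum.distrib)
  qed
  show ?thesis
    unfolding sum using cover by (intro sum_mono mult_left_mono) auto
qed

lemma bprob_cover:
  assumes "finite S" "\<And>A. A \<subseteq> S \<Longrightarrow> A \<in> E \<Longrightarrow> \<exists>F\<in>set Fs. A \<in> F"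
  shows "bprob p S E \<le> (\<Sum>F\<leftarrow>Fs. bprob p S F)"
proof -
  have "(indicator E A :: real) \<le> (\<Sum>F\<leftarrow>Fs. indicator F A)" if sub: "A \<subseteq> S" for A
  proof (cases "A \<in> E")
    case True
    then obtain F where F: "F \<in> set Fs" "A \<in> F" using assms(2)[OF sub] by blast
    have "(indicator F A :: real) \<le> (\<Sum>F\<leftarrow>Fs. indicator F A)"
      using F(1) by (intro member_le_sum_list) auto
    then show ?thesis using True F(2) by simp
  qed (auto intro!: sum_list_nonneg)
  then show ?thesis
    using bprob_weighted_cover[OF assms(1), of "[E]" Fs p] by simp
qed

lemma two_le_card_missing_below:
  assumes "s \<in> missing_below h A" "t \<in> missing_below h A" "s \<noteq> t"
  shows "2 \<le> card (missing_below h A)"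
  using card_mono[OF finite_missing_below, of "{s, t}" h A] assms by simp

text \<open>The cylinder sets \<open>?Cs\<close> are the prefixes for which the least missing sum is 3, 5, 7 or 8; a
  missing 4 or 6 forces a missing 3 or 5.\<close>

lemma fringe_prob_0_ge:
  assumes p: "0 < p" "p \<le> 1" and h: "9 \<le> h"
  defines "q \<equiv> 1 - p"
  shows "p\<^sup>2 * (1 - q ^ 2 - 2 * p * q ^ 3 - 3 * p ^ 2 * q ^ 4 - p ^ 2 * q ^ 5)
    - q\<^sup>2 * (1 + q) * (1 - p\<^sup>2) ^ 3 \<le> fringe_prob p h 0"
proof -
  let ?C = "\<lambda>I J. {A. I \<subseteq> A \<and> A \<inter> J = {}} :: nat set set"
  let ?M = "{A. card (missing_below h A) = 0}"
  \<comment> \<open>The prefix \<open>{0, 1}\<close> has length 2, and three postponed pairs let the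
    tail start at \<open>s = 9\<close>; smaller sums are left to the cylinders.\<close>
  let ?T = "{A. A \<inter> {..<2} = {0, 1} \<and> (\<exists>s<h. 2 * (2 + 3) \<le> s + 1 \<and> s \<notin> A + A)}"
  let ?Cs = "[?C {0,1} {2,3}, ?C {0,1,2} {3,4,5}, ?C {0,1,3} {2,4,5},
    ?C {0,1,2,3} {4,5,6,7}, ?C {0,1,2,4} {3,5,6,7}, ?C {0,1,3,5} {2,4,6,7},
    ?C {0,1,2,5} {3,4,6,7,8}]"
  have cyl: "bprob p {..<h} (?C I J) = p ^ card I * q ^ card J"
    if "I \<subseteq> {..<9}" "J \<subseteq> {..<9}" "I \<inter> J = {}" for I J
    using that p h unfolding q_def by (intro bprob_cylinder) auto
  have tail: "bprob p {..<h} ?T \<le> q\<^sup>2 * (1 + q) * (1 - p\<^sup>2) ^ 3"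
  proof -
    have "bprob p {..<h} ?T \<le> p\<^sup>2 * (q\<^sup>2 * ((1 + q) * (1 - p\<^sup>2) ^ 3 / p\<^sup>2))"
      using bprob_prefix_tail[OF p, of "{0, 1}" 2 h 3] by (simp add: q_def power2_eq_square)
    also have "\<dots> = q\<^sup>2 * (1 + q) * (1 - p\<^sup>2) ^ 3"
      using p by simp
    finally show ?thesis .
  qed
  \<comment> \<open>The sums 0 and 1 are present only if 0 and 1 lie in \<open>A\<close>, so
    starting from this event loses nothing.\<close>
  have cover: "bprob p {..<h} (?C {0,1} {}) \<le> (\<Sum>F\<leftarrow>?M # ?T # ?Cs. bprob p {..<h} F)"
  proof (rule bprob_cover)
    fix A assume A: "A \<in> ?C {0,1} {}"
    then have 01: "0 \<in> A" "1 \<in> A" by auto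
    have "\<exists>F\<in>set ?Cs. A \<in> F" if False: "A \<notin> ?M" "A \<notin> ?T"
    proof -
      \<comment> \<open>The disjuncts are the cylinders of \<open>?Cs\<close>, in that order, in
        terms of membership.\<close>
      have thesisI: ?thesis if "2 \<notin> A \<and> 3 \<notin> A \<or> 2 \<in> A \<and> 3 \<notin> A \<and> 4 \<notin> A \<and> 5 \<notin> A \<or>
          3 \<in> A \<and> 2 \<notin> A \<and> 4 \<notin> A \<and> 5 \<notin> A \<or>
          2 \<in> A \<and> 3 \<in> A \<and> 4 \<notin> A \<and> 5 \<notin> A \<and> 6 \<notin> A \<and> 7 \<notin> A \<or>
          2 \<in> A \<and> 4 \<in> A \<and> 3 \<notin> A \<and> 5 \<notin> A \<and> 6 \<notin> A \<and> 7 \<notin> A \<or>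
          3 \<in> A \<and> 5 \<in> A \<and> 2 \<notin> A \<and> 4 \<notin> A \<and> 6 \<notin> A \<and> 7 \<notin> A \<or>
          2 \<in> A \<and> 5 \<in> A \<and> 3 \<notin> A \<and> 4 \<notin> A \<and> 6 \<notin> A \<and> 7 \<notin> A \<and> 8 \<notin> A"
        using that 01 by (elim disjE) simp_all
      have "missing_below h A \<noteq> {}" using False(1) by auto
      then obtain s where s: "s < h" "s \<notin> A + A"
        by (auto simp: missing_below_def)
      have pre: "A \<inter> {..<2} = {0, 1}" using 01 by auto
      have "s < 9"
      proof (rule ccontr)
        assume "\<not> s < 9"
        then have "2 * (2 + 3) \<le> s + 1" by simp
        then have "A \<in> ?T" using pre s by blast
        then show False using False(2) by simp
      qed
      have no: "a \<notin> A \<or> b \<notin> A" if "a + b = s" for a b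
        using s that by (auto simp: set_plus_def)
      have "s = 0 \<or> s = 1 \<or> s = 2 \<or> s = 3 \<or> s = 4 \<or> s = 5 \<or> s = 6 \<or> s = 7 \<or> s = 8"
        using \<open>s < 9\<close> by (auto simp: less_Suc_eq eval_nat_numeral)
      then show ?thesis
      proof (elim disjE, goal_cases)
        case 1 show ?thesis by (rule thesisI) (use no[of 0 0] 01 1 in auto)
      next
        case 2 show ?thesis by (rule thesisI) (use no[of 0 1] 01 2 in auto)
      next
        case 3 show ?thesis by (rule thesisI) (use no[of 1 1] 01 3 in auto)
      next
        case 4 show ?thesis by (rule thesisI) (use no[of 0 3] no[of 1 2] 01 4 in auto)
      next
        case 5 show ?thesis by (rule thesisI) (use no[of 0 4] no[of 1 3] no[of 2 2] 01 5 in auto)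
      next
        case 6 show ?thesis by (rule thesisI) (use no[of 0 5] no[of 1 4] no[of 2 3] 01 6 in auto)
      next
        case 7 show ?thesis
          by (rule thesisI) (use no[of 0 6] no[of 1 5] no[of 2 4] no[of 3 3] 01 7 in auto)
      next
        case 8 show ?thesis
          by (rule thesisI) (use no[of 0 7] no[of 1 6] no[of 2 5] no[of 3 4] 01 8 in auto)
      next
        case 9 show ?thesis
          by (rule thesisI) (use no[of 0 8] no[of 1 7] no[of 2 6] no[of 3 5] no[of 4 4] 01 9 in auto)
      qed
    qed
    then show "\<exists>F\<in>set (?M # ?T # ?Cs). A \<in> F"
      by (meson list.set_intros)
  qed simp
  have cyls: "bprob p {..<h} (?C {0,1} {}) = p ^ 2"
    "bprob p {..<h} (?C {0,1} {2,3}) = p ^ 2 * q ^ 2"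
    "bprob p {..<h} (?C {0,1,2} {3,4,5}) = p ^ 3 * q ^ 3"
    "bprob p {..<h} (?C {0,1,3} {2,4,5}) = p ^ 3 * q ^ 3"
    "bprob p {..<h} (?C {0,1,2,3} {4,5,6,7}) = p ^ 4 * q ^ 4"
    "bprob p {..<h} (?C {0,1,2,4} {3,5,6,7}) = p ^ 4 * q ^ 4"
    "bprob p {..<h} (?C {0,1,3,5} {2,4,6,7}) = p ^ 4 * q ^ 4"
    "bprob p {..<h} (?C {0,1,2,5} {3,4,6,7,8}) = p ^ 4 * q ^ 5"
    by (subst cyl; simp add: eval_nat_numeral mult.assoc)+
  have "p ^ 2 \<le> fringe_prob p h 0 + (bprob p {..<h} ?T + (p ^ 2 * q ^ 2 + (p ^ 3 * q ^ 3 +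
      (p ^ 3 * q ^ 3 + (p ^ 4 * q ^ 4 + (p ^ 4 * q ^ 4 + (p ^ 4 * q ^ 4 + (p ^ 4 * q ^ 5 + 0))))))))"
    using cover unfolding list.map sum_list.Cons sum_list.Nil cyls fringe_prob_def .
  moreover have "p\<^sup>2 * (1 - q ^ 2 - 2 * p * q ^ 3 - 3 * p ^ 2 * q ^ 4 - p ^ 2 * q ^ 5) =
      p ^ 2 - p ^ 2 * q ^ 2 - 2 * (p ^ 3 * q ^ 3) - 3 * (p ^ 4 * q ^ 4) - p ^ 4 * q ^ 5"
    by (simp add: algebra_simps power2_eq_square power3_eq_cube power4_eq_xxxx)
  ultimately show ?thesis using tail by linarith
qed

text \<open>At most one sum may be missing. Without 0 in \<open>A\<close>, both 0 and 1 are missing.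
  With 0 but not 1, the sum 1 is missing, so 2 and 3 must be present and hence lie in
  \<open>A\<close>. With both 0 and 1, the set must meet \<open>{2, 3, 4}\<close>, as otherwise 3
  and 4 are missing.\<close>

lemma fringe_prob_1_0_le:
  assumes p: "0 < p" "p \<le> 1" and h: "5 \<le> h"
  defines "q \<equiv> 1 - p"
  shows "fringe_prob p h 1 + fringe_prob p h 0 \<le> p ^ 3 * q + p\<^sup>2 * (1 - q ^ 3)"
proof -
  let ?C = "\<lambda>I J. {A. I \<subseteq> A \<and> A \<inter> J = {}} :: nat set set"
  let ?M = "\<lambda>k. {A. card (missing_below h A) = k}"
  have cyl: "bprob p {..<h} (?C I J) = p ^ card I * q ^ card J"
    if "I \<subseteq> {..<5}" "J \<subseteq> {..<5}" "I \<inter> J = {}" for I J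
    using that p h unfolding q_def by (intro bprob_cylinder) auto
  have cover: "(\<Sum>E\<leftarrow>[?M 1, ?M 0, ?C {0,1} {2,3,4}]. bprob p {..<h} E) \<le>
      (\<Sum>F\<leftarrow>[?C {0,2,3} {1}, ?C {0,1} {}]. bprob p {..<h} F)"
  proof (rule bprob_weighted_cover)
    fix A assume "A \<subseteq> {..<h}"
    have mem: "s \<in> missing_below h A \<longleftrightarrow> (\<forall>a\<in>A. \<forall>b\<in>A. a + b \<noteq> s)" if "s < 5" for s
      using that h by (auto simp: missing_below_def set_plus_def)
    have two: "card (missing_below h A) \<noteq> 0 \<and> card (missing_below h A) \<noteq> 1"
      if "s \<in> missing_below h A" "t \<in> missing_below h A" "s \<noteq> t" for s t
      using two_le_card_missing_below[OF that] by auto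
    have one: "card (missing_below h A) \<noteq> 0" if "s \<in> missing_below h A" for s
      using that by auto
    show "(\<Sum>E\<leftarrow>[?M 1, ?M 0, ?C {0,1} {2,3,4}]. indicator E A) \<le>
        (\<Sum>F\<leftarrow>[?C {0,2,3} {1}, ?C {0,1} {}]. indicator F A :: real)"
    proof (cases "0 \<in> A")
      case False
      have "a + b = 0 \<Longrightarrow> a = 0" "a + b = 1 \<Longrightarrow> a = 0 \<or> b = 0" for a b :: nat
        by presburger+
      then have "0 \<in> missing_below h A" "1 \<in> missing_below h A"
        using False by (force simp: mem)+
      then show ?thesis using two[of 0 1] False by (auto simp: indicator_def)
    next
      case 0: True
      show ?thesis
      proof (cases "1 \<in> A")
        case 1: True
        show ?thesis
        proof (cases "A \<inter> {2, 3, 4} = {}")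
          case True
          have *: "a \<le> 1 \<or> 5 \<le> a" if "a \<in> A" for a
          proof (rule ccontr)
            assume "\<not> ?thesis"
            then have "a = 2 \<or> a = 3 \<or> a = 4" by auto
            then show False using True that by auto
          qed
          have "a + b \<noteq> 3 \<and> a + b \<noteq> 4" if "a \<in> A" "b \<in> A" for a b
            using *[OF that(1)] *[OF that(2)] by auto
          then have "3 \<in> missing_below h A" "4 \<in> missing_below h A"
            by (auto simp: mem)
          then show ?thesis using two[of 3 4] 0 1 by (auto simp: indicator_def)
        qed (use 0 1 in \<open>auto simp: indicator_def\<close>)
      next
        case 1: False
        have *: "a + b = 1 \<Longrightarrow> a = 1 \<or> b = 1" "a + b = 2 \<Longrightarrow> a = 2 \<or> b = 2 \<or> a = 1"
          "a + b = 3 \<Longrightarrow> a = 3 \<or> b = 3 \<or> a = 1 \<or> b = 1" for a b :: nat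
          by presburger+
        have "1 \<in> missing_below h A" using 1 *(1) by (force simp: mem)
        moreover have "2 \<in> missing_below h A" if "2 \<notin> A"
          using that 1 *(2) by (force simp: mem)
        moreover have "3 \<in> missing_below h A" if "3 \<notin> A"
          using that 1 *(3) by (force simp: mem)
        ultimately show ?thesis
          using 0 1 one[of 1] two[of 1 2] two[of 1 3] by (auto simp: indicator_def)
      qed
    qed
  qed simp
  have cyls: "bprob p {..<h} (?C {0,1} {2,3,4}) = p ^ 2 * q ^ 3"
    "bprob p {..<h} (?C {0,2,3} {1}) = p ^ 3 * q"
    "bprob p {..<h} (?C {0,1} {}) = p ^ 2"
    by (subst cyl; simp add: eval_nat_numeral mult.assoc)+
  have "fringe_prob p h 1 + (fringe_prob p h 0 + (p ^ 2 * q ^ 3 + 0)) \<le> p ^ 3 * q + (p ^ 2 + 0)"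
    using cover unfolding list.map sum_list.Cons sum_list.Nil cyls fringe_prob_def .
  then show ?thesis by (simp add: algebra_simps)
qed

text \<open>Removing 0 makes the second condition depend on the block \<open>{1..<Suc n}\<close>
  alone, which is independent of the membership of 0 and on which the truncated predecessor is
  injective.\<close>

lemma bprob_shifted:
  assumes p: "0 \<le> p" "p \<le> 1"
  shows "bprob p {..<Suc n} {A. 0 \<notin> A \<and> card (missing_below n ((\<lambda>i. i - 1) ` (A - {0}))) = k} =
    (1 - p) * fringe_prob p n k"
proof -
  let ?g = "\<lambda>i::nat. i - 1" and ?U = "{1..<Suc n}"
  let ?E = "{A. card (missing_below n (?g ` A)) = k}"
  have gU: "?g ` ?U = {..<n}"
  proof (intro equalityI subsetI)
    fix x assume "x \<in> {..<n}"
    then have "x = ?g (Suc x)" "Suc x \<in> ?U" by auto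
    then show "x \<in> ?g ` ?U" by blast
  qed auto
  have "bprob p {..<Suc n} {A. 0 \<notin> A \<and> card (missing_below n (?g ` (A - {0}))) = k} =
      bprob p {..<Suc n} {A. A \<inter> {0} \<in> {A. A \<inter> {0} = {}} \<and> A \<inter> ?U \<in> ?E}"
  proof (rule bprob_cong)
    fix A assume "A \<subseteq> {..<Suc n}"
    then have "A - {0} = A \<inter> ?U" by auto
    then show "A \<in> {A. 0 \<notin> A \<and> card (missing_below n (?g ` (A - {0}))) = k} \<longleftrightarrow>
        A \<in> {A. A \<inter> {0} \<in> {A. A \<inter> {0} = {}} \<and> A \<inter> ?U \<in> ?E}"
      by auto
  qed
  also have "\<dots> = bprob p {0} {A. A \<inter> {0::nat} = {}} * bprob p ?U ?E"
    by (intro bprob_indep) auto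
  also have "bprob p {0} {A. A \<inter> {0::nat} = {}} = 1 - p"
    using bprob_disjoint_all[OF p, of "{0}"] by simp
  also have "bprob p ?U ?E = bprob p (?g ` ?U) {A. card (missing_below n A) = k}"
    by (subst bprob_image) (auto simp: inj_on_def)
  finally show ?thesis unfolding gU fringe_prob_def .
qed

text \<open>For \<open>A = 1 + B\<close> the sumset is \<open>2 + (B + B)\<close>, so only 0 and 1
  can be missing when \<open>B + B\<close> has no gap below \<open>n\<close>.\<close>

lemma missing_below_shift:
  assumes "0 \<notin> A" "missing_below n ((\<lambda>i. i - 1) ` A) = {}"
  shows "missing_below (Suc n) A \<subseteq> {0, 1}"
proof
  fix s assume s: "s \<in> missing_below (Suc n) A"
  show "s \<in> {0, 1}"
  proof (rule ccontr)
    assume "s \<notin> {0, 1}"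
    then have "2 \<le> s" by (cases s) auto
    then have "s - 2 < n" using s by (auto simp: missing_below_def)
    then have "s - 2 \<in> (\<lambda>i. i - 1) ` A + (\<lambda>i. i - 1) ` A"
      using assms(2) by (auto simp: missing_below_def)
    then obtain a b where ab: "a \<in> A" "b \<in> A" "s - 2 = (a - 1) + (b - 1)"
      by (auto simp: set_plus_def)
    then have "0 < a" "0 < b" using assms(1) by (auto intro: gr0I)
    then have "s = a + b" using ab \<open>2 \<le> s\<close> by auto
    then show False using ab s by (auto simp: missing_below_def)
  qed
qed

text \<open>The prefix \<open>{0, 2, 4, 5}\<close> of \<open>{0..5}\<close> already yields all sums up to 10 except 1 and 3.\<close>

lemma fringe_prob_2_ge:
  assumes p: "0 < p" "p \<le> 1" and n: "11 \<le> n"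
  defines "q \<equiv> 1 - p"
  shows "q * fringe_prob p n 0 + (p ^ 4 * q\<^sup>2 - p\<^sup>2 * q ^ 6 * (1 + q)) \<le> fringe_prob p (Suc n) 2"
proof -
  let ?h = "Suc n" and ?D = "{0, 2, 4, 5} :: nat set"
  let ?Z = "{A. 0 \<notin> A \<and> card (missing_below n ((\<lambda>i. i - 1) ` (A - {0}))) = 0}"
  let ?P = "{A. A \<inter> {..<6} = ?D}"
  let ?M = "{A. card (missing_below ?h A) = 2}"
  \<comment> \<open>The condition says \<open>s \<ge> 11\<close>; with \<open>k = 0\<close> the tail
    starts right after the sums settled by the prefix.\<close>
  let ?T = "{A. A \<inter> {..<6} = ?D \<and> (\<exists>s<?h. 2 * (6 + 0) \<le> s + 1 \<and> s \<notin> A + A)}"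
  have P: "bprob p {..<?h} ?P = p ^ 4 * q\<^sup>2"
    using bprob_prefix[of p ?D 6 ?h] p n by (simp add: q_def power4_eq_xxxx mult.assoc)
  have T: "bprob p {..<?h} ?T \<le> p\<^sup>2 * q ^ 6 * (1 + q)"
  proof -
    have "bprob p {..<?h} ?T \<le> p ^ 4 * q\<^sup>2 * (q ^ 4 * ((1 + q) * 1 / p\<^sup>2))"
      using bprob_prefix_tail[OF p, of ?D 6 ?h 0] by (simp add: q_def power4_eq_xxxx mult.assoc)
    also have "\<dots> = p\<^sup>2 * q ^ 6 * (1 + q)"
      using p by (simp add: eval_nat_numeral field_simps)
    finally show ?thesis .
  qed
  \<comment> \<open>Two ways to miss exactly two sums: \<open>?Z\<close> misses 0 and 1, while
    \<open>?P\<close> outside \<open>?T\<close> misses 1 and 3. They are disjoint because 0 lies in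
    \<open>?D\<close>.\<close>
  have "(\<Sum>E\<leftarrow>[?Z, ?P]. bprob p {..<?h} E) \<le> (\<Sum>F\<leftarrow>[?M, ?T]. bprob p {..<?h} F)"
  proof (rule bprob_weighted_cover)
    fix A assume "A \<subseteq> {..<?h}"
    have Z: "A \<in> ?M" if "A \<in> ?Z"
    proof -
      have "0 \<notin> A" using that by simp
      then have "missing_below ?h A \<subseteq> {0, 1}"
        using missing_below_shift[of A n] that by simp
      moreover have "{0, 1} \<subseteq> missing_below ?h A"
      proof -
        have "a + b = 0 \<Longrightarrow> a = 0" "a + b = 1 \<Longrightarrow> a = 0 \<or> b = 0" for a b :: nat
          by presburger+
        then have "0 \<notin> A + A" "1 \<notin> A + A"
          using \<open>0 \<notin> A\<close> by (metis set_plus_elim)+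
        then show ?thesis using n by (simp add: missing_below_def)
      qed
      ultimately have "missing_below ?h A = {0, 1}" by (rule subset_antisym)
      then show ?thesis by simp
    qed
    have M: "A \<in> ?M" if "A \<in> ?P" "A \<notin> ?T"
    proof -
      have mem: "i \<in> A \<longleftrightarrow> i \<in> ?D" if "i < 6" for i
        using \<open>A \<in> ?P\<close> that by blast
      have "s \<in> A + A" if "s < ?h" "s \<noteq> 1" "s \<noteq> 3" for s
      proof (cases "11 \<le> s")
        case True
        then show ?thesis using \<open>A \<in> ?P\<close> \<open>A \<notin> ?T\<close> that by auto
      next
        case False
        have sums: "a + b \<in> A + A" if "a \<in> ?D" "b \<in> ?D" for a b
          using that mem by (intro set_plus_intro) auto
        have "s < 11" using False by simp
        then have "s = 0 \<or> s = 2 \<or> s = 4 \<or> s = 5 \<or> s = 6 \<or> s = 7 \<or> s = 8 \<or> s = 9 \<or> s = 10"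
          using that by (auto simp: less_Suc_eq eval_nat_numeral)
        then show ?thesis
          using sums[of 0 0] sums[of 0 2] sums[of 0 4] sums[of 0 5] sums[of 2 4] sums[of 2 5]
            sums[of 4 4] sums[of 4 5] sums[of 5 5] by (auto simp: numeral_2_eq_2)
      qed
      moreover have "1 \<notin> A + A" "3 \<notin> A + A"
      proof -
        have "1 \<notin> A" "3 \<notin> A" using mem[of 1] mem[of 3] by auto
        moreover have "a + b = 1 \<Longrightarrow> a = 1 \<or> b = 1"
          "a + b = 3 \<Longrightarrow> a = 3 \<or> b = 3 \<or> a = 1 \<or> b = 1" for a b :: nat
          by presburger+
        ultimately show "1 \<notin> A + A" "3 \<notin> A + A"
          by (metis set_plus_elim)+
      qed
      ultimately have "missing_below ?h A = {1, 3}"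
        using n by (auto simp: missing_below_def)
      then show ?thesis by simp
    qed
    have ZP: "A \<notin> ?P" if "A \<in> ?Z" using that by auto
    have two: "(\<Sum>E\<leftarrow>[E1, E2]. indicator E A) \<le> (\<Sum>F\<leftarrow>[F1, F2]. indicator F A :: real)"
      if "A \<in> E1 \<Longrightarrow> A \<in> F1" "A \<in> E2 \<Longrightarrow> A \<notin> F2 \<Longrightarrow> A \<in> F1" "A \<in> E1 \<Longrightarrow> A \<notin> E2"
      for E1 E2 F1 F2
      using that by (auto simp: indicator_def)
    show "(\<Sum>E\<leftarrow>[?Z, ?P]. indicator E A) \<le> (\<Sum>F\<leftarrow>[?M, ?T]. indicator F A :: real)"
      by (rule two[OF Z M ZP])
  qed simp
  moreover have "bprob p {..<?h} ?Z = q * fringe_prob p n 0"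
    using bprob_shifted[of p n 0] p by (simp add: q_def)
  ultimately show ?thesis
    using P T by (simp add: fringe_prob_def)
qed

section \<open>The polynomial inequalities\<close>

text \<open>
  In terms of the polynomials \<open>L\<close>, \<open>K\<close>, \<open>c\<close> of lemma \<open>gap_factor\<close>, the polynomial in
  \<open>peak_poly_pos\<close> is \<open>3 L - 2 K\<close>, and the one in \<open>gap_poly_pos\<close> is
  \<open>((3 + 2 q) L\<^sup>2 + (2 c - 4 K) L + K\<^sup>2) / q\<^sup>2\<close>.
\<close>

lemma peak_poly_pos:
  fixes q :: real
  assumes "0 \<le> q" "q \<le> 8 / 25"
  shows "0 < 1 - 4*q + 4*q^2 - 4*q^3 + 4*q^4 - 7*q^5 - 24*q^6 + 36*q^7 - 12*q^8"
proof -
  \<comment> \<open>Both \<open>q * (1 - q)\<close> and \<open>q * (2 - q)\<close> increase on the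
    interval; the constants are their values at \<open>8 / 25\<close>.\<close>
  have q1: "q * (1 - q) \<le> 136 / 625"
  proof -
    have "0 \<le> (8 / 25 - q) * (17 / 25 - q)" using assms by (intro mult_nonneg_nonneg) auto
    also have "\<dots> = 136 / 625 - q * (1 - q)" by (simp add: field_simps)
    finally show ?thesis by simp
  qed
  have q2: "q * (2 - q) \<le> 336 / 625"
  proof -
    have "0 \<le> (8 / 25 - q) * (42 / 25 - q)" using assms by (intro mult_nonneg_nonneg) auto
    also have "\<dots> = 336 / 625 - q * (2 - q)" by (simp add: field_simps)
    finally show ?thesis by simp
  qed
  have pow: "q ^ k \<le> (8 / 25) ^ k" for k
    using assms by (intro power_mono) auto
  have A: "q * (1 - q) * (1 + q ^ 2) \<le> 136 / 625 * (1 + (8 / 25) ^ 2)"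
    using q1 pow[of 2] assms by (intro mult_mono) auto
  have B': "q * (1 - q) * (q * (2 - q)) \<le> 136 / 625 * (336 / 625)"
    using q1 q2 assms by (intro mult_mono) auto
  have B: "q * (1 - q) * (q * (2 - q)) * q ^ 4 \<le> 136 / 625 * (336 / 625) * (8 / 25) ^ 4"
    by (rule mult_mono[OF B' pow]) (use assms in auto)
  \<comment> \<open>Regrouped so that every subtracted term is a product of nonnegative increasing
    factors, hence largest at \<open>8 / 25\<close>.\<close>
  have "1 - 4*q + 4*q^2 - 4*q^3 + 4*q^4 - 7*q^5 - 24*q^6 + 36*q^7 - 12*q^8 =
      1 - 4 * (q * (1 - q) * (1 + q ^ 2)) - 7 * q ^ 5 - 12 * (q * (1 - q) * (q * (2 - q)) * q ^ 4)"
    by (simp add: algebra_simps eval_nat_numeral)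
  also have "\<dots> \<ge> 1 - 4 * (136 / 625 * (1 + (8 / 25) ^ 2)) - 7 * (8 / 25) ^ 5 -
      12 * (136 / 625 * (336 / 625) * (8 / 25) ^ 4)"
    using A B pow[of 5] by linarith
  moreover have "0 < 1 - 4 * (136 / 625 * (1 + (8 / 25) ^ 2)) - 7 * (8 / 25) ^ 5 -
      12 * (136 / 625 * (336 / 625) * (8 / 25 :: real) ^ 4)"
    by (simp add: field_simps eval_nat_numeral)
  ultimately show ?thesis by linarith
qed

lemma gap_poly_pos:
  fixes q :: real
  assumes "0 \<le> q" "q \<le> 8 / 25"
  shows "0 < 3 - 20*q + 46*q^2 - 46*q^3 + 10*q^4 + 28*q^5 - q^6 + 100*q^7 - 340*q^8 + 438*q^9
    + 38*q^10 - 562*q^11 + 302*q^12 + 160*q^13 - 176*q^14 + 40*q^15"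
proof -
  define s where "s = 8 / 25 - q" \<comment> \<open>Taylor expansion at the right end point, where the margin is smallest\<close>
  have s: "0 \<le> s" "s \<le> 8 / 25" using assms by (auto simp: s_def)
  \<comment> \<open>The coefficient \<open>692/25\<close> is \<open>28 - 8/25\<close>: the term
    \<open>- q^6\<close> is absorbed into \<open>28*q^5\<close> by \<open>mid\<close>.\<close>
  have low: "0 < 3 - 20*q + 46*q^2 - 46*q^3 + 10*q^4 + (692/25)*q^5"
  proof -
    have "0 \<le> s ^ 4 * (6786/125 - 692/25 * s)" using s by (intro mult_nonneg_nonneg) auto
    then have "0 < 197331/244140625 + 3768068/1953125 * s + 1332358/78125 * s^2
        + 15174/3125 * s^3 + s ^ 4 * (6786/125 - 692/25 * s)"
      using s by (intro add_pos_nonneg) auto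
    also have "\<dots> = 3 - 20*q + 46*q^2 - 46*q^3 + 10*q^4 + (692/25)*q^5"
      unfolding s_def by (simp add: field_simps eval_nat_numeral)
    finally show ?thesis .
  qed
  have "0 \<le> (8/25 - q) * q^5" using assms by simp
  then have mid: "q^6 \<le> 8/25 * q^5" by (simp add: algebra_simps eval_nat_numeral)
  \<comment> \<open>Completes the square. The term \<open>438*q^9\<close> is split as
    \<open>300*q^9 + 138*q^9\<close>, one share for \<open>high\<close> and one for
    \<open>top\<close>.\<close>
  have "0 \<le> 300 * (q - 17/30)\<^sup>2 + (100 - 289/3)" by simp
  also have "\<dots> = 100 - 340*q + 300*q^2" by (simp add: power2_eq_square field_simps)
  finally have high: "0 \<le> q^7 * (100 - 340*q + 300*q^2)" using assms by simp
  have "q^2 \<le> (8/25)^2" using assms by (intro power_mono) auto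
  then have "0 \<le> 138 + 38*q - 562*q^2" using assms by (simp add: power2_eq_square)
  then have top: "0 \<le> q^9 * (138 + 38*q - 562*q^2)" using assms by simp
  have rest: "0 \<le> q^12" "0 \<le> q^15" using assms by simp_all
  have "0 \<le> q^13 * (160 - 176*q)" using assms by simp
  moreover have "q^13 * (160 - 176*q) = 160*q^13 - 176*q^14"
    "q^9 * (138 + 38*q - 562*q^2) = 138*q^9 + 38*q^10 - 562*q^11"
    "q^7 * (100 - 340*q + 300*q^2) = 100*q^7 - 340*q^8 + 300*q^9"
    by (simp_all add: algebra_simps flip: power_add power_Suc)
  ultimately show ?thesis using low mid high top rest by linarith
qed

text \<open>The first claim is \<open>x\<^sub>1 \<le> K - x\<^sub>0 < x\<^sub>0 / 2\<close>. For the
  second, \<open>2 * x\<^sub>0 * x\<^sub>2 + x\<^sub>1\<^sup>2 - 2 * x\<^sub>0 * x\<^sub>1 = 2 *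
  x\<^sub>0 * x\<^sub>2 - x\<^sub>0\<^sup>2 + (x\<^sub>0 - x\<^sub>1)\<^sup>2\<close>, and
  \<open>x\<^sub>0 - x\<^sub>1 \<ge> 2 * x\<^sub>0 - K > 0\<close>. This leaves a quadratic in
  \<open>x\<^sub>0\<close> that for \<open>x\<^sub>0 \<ge> L\<close> is at least its value at
  \<open>L\<close>, positive by \<open>gap\<close>.\<close>

lemma fringe_inequalities:
  fixes x\<^sub>0 x\<^sub>1 x\<^sub>2 L K c q :: real
  assumes x: "L \<le> x\<^sub>0" "x\<^sub>1 + x\<^sub>0 \<le> K" "q * x\<^sub>0 + c \<le> x\<^sub>2"
    and L: "0 < L" "2 * K < 3 * L" and "0 \<le> c" "0 \<le> q"
    and gap: "0 < (3 + 2 * q) * L\<^sup>2 + (2 * c - 4 * K) * L + K\<^sup>2"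
  shows "2 * x\<^sub>0 * x\<^sub>1 < x\<^sub>0\<^sup>2" "2 * x\<^sub>0 * x\<^sub>1 < 2 * x\<^sub>0 * x\<^sub>2 + x\<^sub>1\<^sup>2"
proof -
  have x0: "0 < x\<^sub>0" using x L by linarith
  have "2 * x\<^sub>1 < x\<^sub>0" using x L by linarith
  then have "x\<^sub>0 * (2 * x\<^sub>1) < x\<^sub>0 * x\<^sub>0" using x0 by simp
  then show "2 * x\<^sub>0 * x\<^sub>1 < x\<^sub>0\<^sup>2" by (simp add: power2_eq_square algebra_simps)
  have "0 \<le> (x\<^sub>0 - L) * ((3 + 2 * q) * (x\<^sub>0 + L) + 2 * c - 4 * K)"
  proof (intro mult_nonneg_nonneg)
    have "4 * K \<le> 3 * x\<^sub>0 + 3 * L"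
      using x(1) L by linarith
    also have "\<dots> = 3 * (x\<^sub>0 + L)"
      by simp
    also have "\<dots> \<le> (3 + 2 * q) * (x\<^sub>0 + L)"
      using x0 L \<open>0 \<le> q\<close> by (intro mult_right_mono) auto
    finally show "0 \<le> (3 + 2 * q) * (x\<^sub>0 + L) + 2 * c - 4 * K"
      using \<open>0 \<le> c\<close> by simp
  qed (use x in simp)
  also have "\<dots> = ((3 + 2 * q) * x\<^sub>0\<^sup>2 + (2 * c - 4 * K) * x\<^sub>0 + K\<^sup>2) -
      ((3 + 2 * q) * L\<^sup>2 + (2 * c - 4 * K) * L + K\<^sup>2)"
    by (simp add: power2_eq_square algebra_simps)
  finally have "0 < (3 + 2 * q) * x\<^sub>0\<^sup>2 + (2 * c - 4 * K) * x\<^sub>0 + K\<^sup>2"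
    using gap by linarith
  also have "\<dots> = 2 * (x\<^sub>0 * (q * x\<^sub>0 + c)) - x\<^sub>0\<^sup>2 + (2 * x\<^sub>0 - K)\<^sup>2"
    by (simp add: power2_eq_square algebra_simps)
  also have "\<dots> \<le> 2 * (x\<^sub>0 * x\<^sub>2) - x\<^sub>0\<^sup>2 + (x\<^sub>0 - x\<^sub>1)\<^sup>2"
  proof -
    have "(2 * x\<^sub>0 - K)\<^sup>2 \<le> (x\<^sub>0 - x\<^sub>1)\<^sup>2"
      using x L x0 by (intro power_mono) auto
    moreover have "x\<^sub>0 * (q * x\<^sub>0 + c) \<le> x\<^sub>0 * x\<^sub>2"
      using x(3) x0 by (intro mult_left_mono) auto
    ultimately show ?thesis by linarith
  qed
  finally show "2 * x\<^sub>0 * x\<^sub>1 < 2 * x\<^sub>0 * x\<^sub>2 + x\<^sub>1\<^sup>2"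
    by (simp add: power2_eq_square algebra_simps)
qed

section \<open>Substitution of the bounds and conclusion\<close>

lemma bounds_in_q:
  fixes p :: real
  defines "q \<equiv> 1 - p"
  shows "p\<^sup>2 * (1 - q ^ 2 - 2 * p * q ^ 3 - 3 * p ^ 2 * q ^ 4 - p ^ 2 * q ^ 5) - q\<^sup>2 * (1 + q) * (1 - p\<^sup>2) ^ 3 =
    1 - 2*q + 2*q^4 - 3*q^5 - 8*q^6 + 12*q^7 - 4*q^8"
  "p ^ 3 * q + p\<^sup>2 * (1 - q ^ 3) = 1 - q - 2*q^2 + 2*q^3 + q^4 - q^5"
  "p ^ 4 * q\<^sup>2 - p\<^sup>2 * q ^ 6 * (1 + q) = q^2 - 4*q^3 + 6*q^4 - 4*q^5 + q^7 + q^8 - q^9"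
proof -
  have p: "p = 1 - q" by (simp add: q_def)
  show "p\<^sup>2 * (1 - q ^ 2 - 2 * p * q ^ 3 - 3 * p ^ 2 * q ^ 4 - p ^ 2 * q ^ 5) - q\<^sup>2 * (1 + q) * (1 - p\<^sup>2) ^ 3 =
    1 - 2*q + 2*q^4 - 3*q^5 - 8*q^6 + 12*q^7 - 4*q^8"
    unfolding p by algebra
  show "p ^ 3 * q + p\<^sup>2 * (1 - q ^ 3) = 1 - q - 2*q^2 + 2*q^3 + q^4 - q^5"
    unfolding p by algebra
  show "p ^ 4 * q\<^sup>2 - p\<^sup>2 * q ^ 6 * (1 + q) = q^2 - 4*q^3 + 6*q^4 - 4*q^5 + q^7 + q^8 - q^9"
    unfolding p by algebra
qed

text \<open>The expression vanishes to second order at \<open>q = 0\<close>; dividing out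
  \<open>q^2\<close> leaves a polynomial with constant term 3, whose positivity holds
  uniformly.\<close>

lemma gap_factor:
  fixes q L K c :: real
  assumes "L = 1 - 2*q + 2*q^4 - 3*q^5 - 8*q^6 + 12*q^7 - 4*q^8"
    "K = 1 - q - 2*q^2 + 2*q^3 + q^4 - q^5"
    "c = q^2 - 4*q^3 + 6*q^4 - 4*q^5 + q^7 + q^8 - q^9"
  shows "(3 + 2 * q) * L\<^sup>2 + (2 * c - 4 * K) * L + K\<^sup>2 = q^2 *
    (3 - 20*q + 46*q^2 - 46*q^3 + 10*q^4 + 28*q^5 - q^6 + 100*q^7 - 340*q^8 + 438*q^9
    + 38*q^10 - 562*q^11 + 302*q^12 + 160*q^13 - 176*q^14 + 40*q^15)"
  unfolding assms by algebra

lemma fringe_lim_bounds: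
  assumes p: "0 < p" "p \<le> 1"
  defines "q \<equiv> 1 - p"
  shows "p\<^sup>2 * (1 - q ^ 2 - 2 * p * q ^ 3 - 3 * p ^ 2 * q ^ 4 - p ^ 2 * q ^ 5)
      - q\<^sup>2 * (1 + q) * (1 - p\<^sup>2) ^ 3 \<le> fringe_lim p 0"
    "fringe_lim p 1 + fringe_lim p 0 \<le> p ^ 3 * q + p\<^sup>2 * (1 - q ^ 3)"
    "q * fringe_lim p 0 + (p ^ 4 * q\<^sup>2 - p\<^sup>2 * q ^ 6 * (1 + q)) \<le> fringe_lim p 2"
proof -
  note lim = fringe_prob_tendsto[OF p]
  show "p\<^sup>2 * (1 - q ^ 2 - 2 * p * q ^ 3 - 3 * p ^ 2 * q ^ 4 - p ^ 2 * q ^ 5)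
      - q\<^sup>2 * (1 + q) * (1 - p\<^sup>2) ^ 3 \<le> fringe_lim p 0"
    unfolding q_def by (rule LIMSEQ_le_const[OF lim]) (use fringe_prob_0_ge[OF p] in blast)
  show "fringe_lim p 1 + fringe_lim p 0 \<le> p ^ 3 * q + p\<^sup>2 * (1 - q ^ 3)"
    unfolding q_def
    by (rule LIMSEQ_le_const2[OF tendsto_add[OF lim lim]]) (use fringe_prob_1_0_le[OF p] in blast)
  have "(\<lambda>n. q * fringe_prob p n 0 + (p ^ 4 * q\<^sup>2 - p\<^sup>2 * q ^ 6 * (1 + q))) \<longlonglongrightarrow>
      q * fringe_lim p 0 + (p ^ 4 * q\<^sup>2 - p\<^sup>2 * q ^ 6 * (1 + q))"
    by (intro tendsto_intros lim)
  \<comment> \<open>The shift of \<open>A\<close> by one makes the window on the right longer by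
    one, which does not change the limit.\<close>
  from LIMSEQ_le[OF this LIMSEQ_Suc[OF lim, of 2]]
  show "q * fringe_lim p 0 + (p ^ 4 * q\<^sup>2 - p\<^sup>2 * q ^ 6 * (1 + q)) \<le> fringe_lim p 2"
    using fringe_prob_2_ge[OF p] unfolding q_def by blast
qed

theorem theorem1p5:
  shows "(\<forall>p k. 0 < p \<and> p < 1 \<longrightarrow> convergent (\<lambda>n. missing_prob n p k)) \<and>
         (\<forall>p. 0.68 \<le> p \<and> p < 1 \<longrightarrow>
            missing_lim_prob p 0 > missing_lim_prob p 1 \<and>
            missing_lim_prob p 1 < missing_lim_prob p 2)"
proof (intro conjI allI impI)
  fix p :: real and k assume "0 < p \<and> p < 1"
  then show "convergent (\<lambda>n. missing_prob n p k)"
    using missing_prob_tendsto[of p k] by (auto simp: convergent_def)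
next
  fix p :: real assume "0.68 \<le> p \<and> p < 1"
  \<comment> \<open>Here \<open>8 / 25\<close> is \<open>1 - 0.68\<close>.\<close>
  then have p: "0 < p" "p \<le> 1" and q: "0 < 1 - p" "1 - p \<le> 8 / 25" by auto
  define q where "q = 1 - p"
  define L where "L = 1 - 2*q + 2*q^4 - 3*q^5 - 8*q^6 + 12*q^7 - 4*q^8"
  define K where "K = 1 - q - 2*q^2 + 2*q^3 + q^4 - q^5"
  define c where "c = q^2 - 4*q^3 + 6*q^4 - 4*q^5 + q^7 + q^8 - q^9"
  have bounds: "L \<le> fringe_lim p 0" "fringe_lim p 1 + fringe_lim p 0 \<le> K"
    "q * fringe_lim p 0 + c \<le> fringe_lim p 2"
    using fringe_lim_bounds[OF p] unfolding bounds_in_q L_def K_def c_def q_def by simp_all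
  have q': "0 < q" "q \<le> 8 / 25" using q by (simp_all add: q_def)
  have F: "2 * K < 3 * L"
    using peak_poly_pos[of q] q' unfolding K_def L_def by simp
  \<comment> \<open>Together with \<open>2 * K < 3 * L\<close> this yields
    \<open>0 < L\<close>.\<close>
  have K: "0 \<le> K"
  proof -
    have "K = p ^ 3 * q + p\<^sup>2 * (1 - q ^ 3)"
      using bounds_in_q(2)[of p] by (simp add: K_def q_def)
    moreover have "q ^ 3 \<le> 1" using q' by (intro power_le_one) auto
    ultimately show ?thesis using p q' by simp
  qed
  have c: "0 \<le> c"
  proof -
    have "c = p\<^sup>2 * q\<^sup>2 * (p\<^sup>2 - q ^ 4 - q ^ 5)"
      unfolding c_def q_def by algebra
    moreover have "q ^ 4 \<le> (8 / 25) ^ 4" "q ^ 5 \<le> (8 / 25) ^ 5" "(17 / 25)\<^sup>2 \<le> p\<^sup>2"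
      using q' q by (intro power_mono; simp)+
    then have "0 \<le> p\<^sup>2 - q ^ 4 - q ^ 5" by (simp add: eval_nat_numeral)
    ultimately show ?thesis by simp
  qed
  have gap: "0 < (3 + 2 * q) * L\<^sup>2 + (2 * c - 4 * K) * L + K\<^sup>2"
    unfolding gap_factor[OF L_def K_def c_def] using gap_poly_pos[of q] q' by simp
  have "0 < L" using F K by linarith
  note ineq = fringe_inequalities[OF bounds \<open>0 < L\<close> F c less_imp_le[OF q'(1)] gap]
  have lim: "missing_lim_prob p k = (\<Sum>i\<le>k. fringe_lim p i * fringe_lim p (k - i))" for k
    unfolding missing_lim_prob_def by (rule limI[OF missing_prob_tendsto[OF p]])
  show "missing_lim_prob p 0 > missing_lim_prob p 1" "missing_lim_prob p 1 < missing_lim_prob p 2"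
    using ineq by (simp_all add: lim eval_nat_numeral algebra_simps)
qed

end
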